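(* Let $V$ be a finite set and let $f\colon V\to V$ be any function. Let $\le$ be the functional preorder on $V$ induced by $f$, and let $\mathcal{I}(V,\le)$ be the family of order ideals of $(V,\le)$. Then $$\operatorname{NDS}\bigl(\mathcal{I}(V,\le)\bigr)\le 0 .$$
   Context: The functional preorder on $V$ induced by $f\colon V\to V$ is the reflexive-transitive closure of the relation $\lessdot$ defined by $v\lessdot w$ if and only if $f(v)=w$ and $f(v)\neq v$. For a preordered set $(V,\le)$, a subset $I\subseteq V$ is an order ideal if $x\in I$ and $y\le x$ imply $y\in I$; $\mathcal{I}(V,\le)$ denotes the family of all order ideals (it contains $\varnothing$ and $V$). For a family $\mathcal F\subseteq 2^V$ of subsets of a finite ground set $V$, the normalized degree sum is the integer $\operatorname{NDS}(\mathcal F)=2\sum_{F\in\mathcal F}|F|-|\mathcal F|\,|V|$. *)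

theory Defs
  imports Main "HOL-Library.FuncSet"
begin

text \<open>The ground set is an explicit carrier \<open>V\<close> and preorders on it are relations
  contained in \<open>V \<times> V\<close>.\<close>

definition functional_step :: "'a set \<Rightarrow> ('a \<Rightarrow> 'a) \<Rightarrow> 'a rel" where
  "functional_step V f = {(v, w) \<in> V \<times> V. f v = w \<and> f v \<noteq> v}"

text \<open>The library's closure \<open>\<^sup>*\<close> is reflexive on the whole type, so it is cut down to \<open>V\<close>.
  A pair \<open>(v, w)\<close> in the relation means \<open>v \<le> w\<close>.\<close>

definition functional_preorder :: "'a set \<Rightarrow> ('a \<Rightarrow> 'a) \<Rightarrow> 'a rel" where
  "functional_preorder V f = Restr ((functional_step V f)\<^sup>*) V"

lemma preorder_on_functional_preorder: "preorder_on V (functional_preorder V f)"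
  by (auto simp: preorder_on_def functional_preorder_def refl_on_def intro!: transI)

definition order_ideals :: "'a set \<Rightarrow> 'a rel \<Rightarrow> 'a set set" where
  "order_ideals V r = {I. I \<subseteq> V \<and> (\<forall>x\<in>I. \<forall>y\<in>V. (y, x) \<in> r \<longrightarrow> y \<in> I)}"

definition NDS :: "'a set \<Rightarrow> 'a set set \<Rightarrow> int" where
  "NDS V \<F> = 2 * (\<Sum>F\<in>\<F>. int (card F)) - int (card \<F>) * int (card V)"

end

theory Submission
  imports Defs
begin

text \<open>
  The order ideals of the functional preorder are the subsets of \<open>V\<close> that contain every
  \<open>f\<close>-preimage of their members. This description still makes sense when \<open>f\<close> leaves the
  ground set, and in that generality the inequality is proved by induction on the ground set.

  Take a minimal nonempty forward-closed set \<open>R\<close> of size \<open>r\<close> (a cycle of \<open>f\<close>, or a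
  point that \<open>f\<close> sends out of \<open>V\<close>), and let \<open>D\<close> be the least ideal containing \<open>R\<close>, of size
  \<open>d\<close>. By minimality an ideal either avoids \<open>R\<close>, and is then an ideal of \<open>V - R\<close>, or it
  contains \<open>D\<close>, and is then \<open>D\<close> together with an ideal of \<open>V - D\<close>. Writing \<open>a\<close> and \<open>c\<close> for the
  numbers of ideals of \<open>V - R\<close> and \<open>V - D\<close>, this gives
  \<open>NDS V = NDS (V - R) + NDS (V - D) - r * a + d * c\<close>,
  where \<open>NDS W\<close> refers to the ideals of \<open>W\<close>.
  The first two summands are nonpositive by induction. For the rest, reaching \<open>D\<close> from \<open>R\<close> by
  adding one preimage at a time produces a chain of \<open>d - r + 1\<close> ideals of \<open>D - R\<close>,
  each of which can be combined with every ideal of \<open>V - D\<close>. Hence \<open>a \<ge> (d - r + 1) * c\<close>,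
  and \<open>r * (d - r + 1) \<ge> d\<close> because \<open>(r - 1) * (d - r) \<ge> 0\<close>.
\<close>

section \<open>Ideals as sets closed under preimages\<close>

definition preimage_closed_sets :: "'a set \<Rightarrow> ('a \<Rightarrow> 'a) \<Rightarrow> 'a set set" where
  "preimage_closed_sets V f = {I. I \<subseteq> V \<and> (\<forall>y\<in>V. f y \<in> I \<longrightarrow> y \<in> I)}"

lemma preimage_closed_setsI:
  "I \<subseteq> V \<Longrightarrow> (\<And>y. y \<in> V \<Longrightarrow> f y \<in> I \<Longrightarrow> y \<in> I) \<Longrightarrow> I \<in> preimage_closed_sets V f"
  by (auto simp: preimage_closed_sets_def)

lemma preimage_closed_setsD:
  assumes "I \<in> preimage_closed_sets V f"
  shows "I \<subseteq> V" and "\<And>y. y \<in> V \<Longrightarrow> f y \<in> I \<Longrightarrow> y \<in> I"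
  using assms by (auto simp: preimage_closed_sets_def)

lemma finite_preimage_closed_sets: "finite V \<Longrightarrow> finite (preimage_closed_sets V f)"
  by (rule finite_subset[of _ "Pow V"]) (auto simp: preimage_closed_sets_def)

lemma order_ideals_functional_preorder:
  assumes "f \<in> V \<rightarrow> V"
  shows "order_ideals V (functional_preorder V f) = preimage_closed_sets V f"
proof (intro equalityI subsetI)
  fix I assume I: "I \<in> order_ideals V (functional_preorder V f)"
  show "I \<in> preimage_closed_sets V f"
  proof (rule preimage_closed_setsI)
    show "I \<subseteq> V" using I by (auto simp: order_ideals_def)
    fix y assume y: "y \<in> V" "f y \<in> I"
    show "y \<in> I"
    proof (cases "f y = y")
      case False
      then have "(y, f y) \<in> functional_preorder V f"
        using y assms by (auto simp: functional_preorder_def functional_step_def)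
      then show ?thesis using I y by (auto simp: order_ideals_def)
    qed (use y in simp)
  qed
next
  fix I assume I: "I \<in> preimage_closed_sets V f"
  have "y \<in> I" if "(y, x) \<in> (functional_step V f)\<^sup>*" "x \<in> I" for x y
    using that
    by (induction rule: converse_rtrancl_induct)
      (use preimage_closed_setsD(2)[OF I] in \<open>auto simp: functional_step_def\<close>)
  then show "I \<in> order_ideals V (functional_preorder V f)"
    using preimage_closed_setsD(1)[OF I]
    by (auto simp: order_ideals_def functional_preorder_def)
qed

section \<open>Splitting by a minimal forward-closed set\<close>

text \<open>Leaving the ground set is permitted, so a single point that \<open>f\<close> sends out of \<open>V\<close>
  is forward closed.\<close>

definition forward_closed :: "'a set \<Rightarrow> ('a \<Rightarrow> 'a) \<Rightarrow> 'a set \<Rightarrow> bool" where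
  "forward_closed V f R \<longleftrightarrow> R \<subseteq> V \<and> (\<forall>y\<in>R. f y \<in> V \<longrightarrow> f y \<in> R)"

lemma minimal_forward_closed_exists:
  assumes "finite V" "V \<noteq> {}"
  obtains R where "forward_closed V f R" "R \<noteq> {}"
    "\<And>S. forward_closed V f S \<Longrightarrow> S \<noteq> {} \<Longrightarrow> S \<subseteq> R \<Longrightarrow> S = R"
proof -
  let ?A = "{R. forward_closed V f R \<and> R \<noteq> {}}"
  have "finite ?A"
    by (rule finite_subset[of _ "Pow V"]) (use assms in \<open>auto simp: forward_closed_def\<close>)
  moreover have "V \<in> ?A" using assms by (auto simp: forward_closed_def)
  ultimately obtain R where "R \<in> ?A" "\<forall>S\<in>?A. S \<subseteq> R \<longrightarrow> R = S"
    using finite_has_minimal[of ?A] by blast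
  then show thesis using that by blast
qed

text \<open>The part of \<open>R\<close> outside an ideal is again forward closed.\<close>

lemma minimal_forward_closed_subset_or_disjoint:
  assumes R: "forward_closed V f R"
    and min: "\<And>S. forward_closed V f S \<Longrightarrow> S \<noteq> {} \<Longrightarrow> S \<subseteq> R \<Longrightarrow> S = R"
    and I: "I \<in> preimage_closed_sets V f"
  shows "R \<subseteq> I \<or> R \<inter> I = {}"
proof (rule disjCI)
  have "forward_closed V f (R - I)"
    using R preimage_closed_setsD(2)[OF I] by (auto simp: forward_closed_def)
  moreover assume "R \<inter> I \<noteq> {}"
  ultimately show "R \<subseteq> I" using min[of "R - I"] by blast
qed

definition generated_ideal :: "'a set \<Rightarrow> ('a \<Rightarrow> 'a) \<Rightarrow> 'a set \<Rightarrow> 'a set" where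
  "generated_ideal V f R = \<Inter>{I \<in> preimage_closed_sets V f. R \<subseteq> I}"

lemma generated_ideal_least:
  "I \<in> preimage_closed_sets V f \<Longrightarrow> R \<subseteq> I \<Longrightarrow> generated_ideal V f R \<subseteq> I"
  by (auto simp: generated_ideal_def)

lemma subset_generated_ideal: "R \<subseteq> generated_ideal V f R"
  by (auto simp: generated_ideal_def)

lemma generated_ideal_preimage_closed:
  assumes "R \<subseteq> V"
  shows "generated_ideal V f R \<in> preimage_closed_sets V f"
proof (rule preimage_closed_setsI)
  have "V \<in> preimage_closed_sets V f" by (auto simp: preimage_closed_sets_def)
  then show "generated_ideal V f R \<subseteq> V" using assms by (rule generated_ideal_least)
qed (auto simp: generated_ideal_def dest: preimage_closed_setsD)

text \<open>Passing from \<open>V - R\<close> to \<open>V\<close> adds the closure condition at the points of \<open>R\<close>. It holds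
  vacuously: such a point stays in \<open>R\<close> or leaves \<open>V\<close>, so it is never mapped into a set
  that avoids \<open>R\<close>.\<close>

lemma preimage_closed_sets_avoiding:
  assumes "forward_closed V f R"
  shows "{I \<in> preimage_closed_sets V f. R \<inter> I = {}} = preimage_closed_sets (V - R) f"
  using assms unfolding preimage_closed_sets_def forward_closed_def by blast

lemma preimage_closed_sets_containing:
  assumes "D \<in> preimage_closed_sets V f"
  shows "{I \<in> preimage_closed_sets V f. D \<subseteq> I} = (\<union>) D ` preimage_closed_sets (V - D) f"
proof (intro equalityI subsetI)
  fix I assume "I \<in> {I \<in> preimage_closed_sets V f. D \<subseteq> I}"
  then have "I - D \<in> preimage_closed_sets (V - D) f" "I = D \<union> (I - D)"
    by (auto simp: preimage_closed_sets_def)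
  then show "I \<in> (\<union>) D ` preimage_closed_sets (V - D) f" by (rule rev_image_eqI)
next
  fix I assume "I \<in> (\<union>) D ` preimage_closed_sets (V - D) f"
  then show "I \<in> {I \<in> preimage_closed_sets V f. D \<subseteq> I}"
    using assms by (auto simp: preimage_closed_sets_def)
qed

lemma inj_on_union_disjoint:
  assumes "\<And>J. J \<in> \<F> \<Longrightarrow> D \<inter> J = {}"
  shows "inj_on ((\<union>) D) \<F>"
  using assms by (intro inj_onI) blast

section \<open>Counting the ideals that avoid the minimal set\<close>

text \<open>Induction on \<open>D - E\<close>. As long as \<open>E\<close> is not all of \<open>D\<close>, it is not an ideal, so some
  point \<open>y\<close> outside \<open>E\<close> is mapped into \<open>E\<close>. Moving \<open>y\<close> into \<open>E\<close> loses at least those ideals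
  of \<open>V - E\<close> that consist of \<open>D - E\<close> and an ideal of \<open>V - D\<close>, since they contain \<open>y\<close>.\<close>

lemma card_preimage_closed_sets_diff_ge:
  assumes "finite V" "R \<subseteq> V" "R \<subseteq> E" "E \<subseteq> generated_ideal V f R"
  defines "D \<equiv> generated_ideal V f R"
  shows "(card (D - E) + 1) * card (preimage_closed_sets (V - D) f)
    \<le> card (preimage_closed_sets (V - E) f)"
proof -
  have D: "D \<in> preimage_closed_sets V f"
    unfolding D_def using assms(2) by (rule generated_ideal_preimage_closed)
  note D_sub = preimage_closed_setsD(1)[OF D] and D_pre = preimage_closed_setsD(2)[OF D]
  have fin: "finite D" using D_sub assms(1) by (rule finite_subset)
  show ?thesis
    using assms(3,4)
  proof (induction "card (D - E)" arbitrary: E)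
    case 0
    then have "D = E" using fin unfolding D_def[symmetric] by auto
    then show ?case by simp
  next
    case (Suc n)
    have E: "R \<subseteq> E" "E \<subseteq> D" using Suc.prems unfolding D_def by auto
    have "E \<noteq> D" using Suc.hyps(2) by auto
    then have "E \<notin> preimage_closed_sets V f"
      using generated_ideal_least[of E V f R] E unfolding D_def by blast
    then obtain y where y: "y \<in> V" "f y \<in> E" "y \<notin> E"
      using E D_sub by (auto simp: preimage_closed_sets_def)
    with E D_pre have yD: "y \<in> D" by blast
    let ?A = "preimage_closed_sets (V - insert y E) f"
    let ?B = "(\<union>) (D - E) ` preimage_closed_sets (V - D) f"
    have "D - E = insert y (D - insert y E)" using y yD by auto
    then have card: "card (D - E) = Suc (card (D - insert y E))"
      using fin by (metis DiffD2 card_insert_disjoint finite_Diff insertI1)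
    then have "(card (D - insert y E) + 1) * card (preimage_closed_sets (V - D) f) \<le> card ?A"
      using E yD Suc.hyps(2) Suc.hyps(1)[of "insert y E"] by (auto simp: D_def)
    moreover have "card ?B = card (preimage_closed_sets (V - D) f)"
      by (intro card_image inj_on_union_disjoint) (auto simp: preimage_closed_sets_def)
    ultimately have "(card (D - E) + 1) * card (preimage_closed_sets (V - D) f)
        \<le> card ?A + card ?B"
      using card by simp
    also have "\<dots> = card (?A \<union> ?B)"
    proof (rule card_Un_disjoint[symmetric])
      show "?A \<inter> ?B = {}" using y yD by (auto simp: preimage_closed_sets_def)
    qed (use assms(1) in \<open>auto intro: finite_preimage_closed_sets\<close>)
    also have "\<dots> \<le> card (preimage_closed_sets (V - E) f)"
    proof (rule card_mono)
      have "?A \<subseteq> preimage_closed_sets (V - E) f"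
        using y unfolding preimage_closed_sets_def by blast
      moreover have "?B \<subseteq> preimage_closed_sets (V - E) f"
        using E D_sub D_pre by (auto simp: preimage_closed_sets_def)
      ultimately show "?A \<union> ?B \<subseteq> preimage_closed_sets (V - E) f" by blast
    qed (use assms(1) in \<open>auto intro: finite_preimage_closed_sets\<close>)
    finally show ?case .
  qed
qed

section \<open>The inequality\<close>

lemma NDS_eq_sum: "NDS V \<F> = (\<Sum>F\<in>\<F>. 2 * int (card F) - int (card V))"
  by (simp add: NDS_def sum_subtractf sum_distrib_left)

text \<open>The induction hypothesis is applied to \<open>V - R\<close>, from which \<open>f\<close> may lead into \<open>R\<close>; this
  is why \<open>f\<close> is not required to map the ground set to itself.\<close>

lemma NDS_preimage_closed_sets_nonpos:
  assumes "finite V"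
  shows "NDS V (preimage_closed_sets V f) \<le> 0"
  using assms
proof (induction V rule: finite_psubset_induct)
  case (psubset V)
  show ?case
  proof (cases "V = {}")
    case True
    then show ?thesis by (auto simp: NDS_eq_sum preimage_closed_sets_def intro: sum_nonpos)
  next
    case False
    then obtain R where R: "forward_closed V f R" "R \<noteq> {}"
      and min: "\<And>S. forward_closed V f S \<Longrightarrow> S \<noteq> {} \<Longrightarrow> S \<subseteq> R \<Longrightarrow> S = R"
      using minimal_forward_closed_exists[OF psubset.hyps] by blast
    define D where "D = generated_ideal V f R"
    have RV: "R \<subseteq> V" using R by (simp add: forward_closed_def)
    have RD: "R \<subseteq> D" unfolding D_def by (rule subset_generated_ideal)
    have D: "D \<in> preimage_closed_sets V f"
      unfolding D_def using RV by (rule generated_ideal_preimage_closed)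
    have DV: "D \<subseteq> V" using D by (rule preimage_closed_setsD)
    have fin: "finite D" "finite R" using DV RV psubset.hyps by (auto intro: finite_subset)
    let ?A = "preimage_closed_sets (V - R) f"
    let ?C = "preimage_closed_sets (V - D) f"
    have finAC: "finite ?A" "finite ?C"
      using psubset.hyps by (auto intro: finite_preimage_closed_sets)
    \<comment> \<open>An ideal that does not avoid \<open>R\<close> contains it, and hence contains \<open>D\<close>.\<close>
    have split: "preimage_closed_sets V f = ?A \<union> (\<union>) D ` ?C"
      using minimal_forward_closed_subset_or_disjoint[OF R(1) min]
        generated_ideal_least[of _ V f R, folded D_def]
      unfolding preimage_closed_sets_avoiding[OF R(1), symmetric]
        preimage_closed_sets_containing[OF D, symmetric] by blast
    have disj: "?A \<inter> (\<union>) D ` ?C = {}"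
      using RD R(2) by (auto simp: preimage_closed_sets_def)
    have inj: "inj_on ((\<union>) D) ?C"
      by (rule inj_on_union_disjoint) (auto simp: preimage_closed_sets_def)
    have cV: "int (card (V - R)) = int (card V) - int (card R)"
      "int (card (V - D)) = int (card V) - int (card D)"
      "int (card (D - R)) = int (card D) - int (card R)"
      using RV DV RD fin psubset.hyps by (simp_all add: card_Diff_subset card_mono of_nat_diff)
    have "(\<Sum>J\<in>?C. 2 * int (card (D \<union> J)) - int (card V))
        = (\<Sum>J\<in>?C. (2 * int (card J) - int (card (V - D))) + int (card D))"
    proof (rule sum.cong)
      fix J assume "J \<in> ?C"
      then have "J \<subseteq> V - D" by (rule preimage_closed_setsD)
      then have "card (D \<union> J) = card D + card J"
        using fin psubset.hyps by (intro card_Un_disjoint) (auto intro: finite_subset)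
      then show "2 * int (card (D \<union> J)) - int (card V)
          = (2 * int (card J) - int (card (V - D))) + int (card D)"
        using cV by simp
    qed simp
    then have "NDS V (preimage_closed_sets V f)
        = (\<Sum>J\<in>?A. 2 * int (card J) - int (card V))
          + (\<Sum>J\<in>?C. (2 * int (card J) - int (card (V - D))) + int (card D))"
      unfolding NDS_eq_sum split using finAC disj inj
      by (simp add: sum.union_disjoint sum.reindex)
    also have "\<dots> = NDS (V - R) ?A + NDS (V - D) ?C
        - int (card R) * int (card ?A) + int (card D) * int (card ?C)"
      by (simp add: NDS_def cV sum_subtractf sum.distrib sum_distrib_left algebra_simps)
    also have "\<dots> \<le> 0"
    proof -
      have "NDS (V - R) ?A \<le> 0" "NDS (V - D) ?C \<le> 0"
        using R(2) RV RD DV by (intro psubset.IH; blast)+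
      moreover have "int (card D) * int (card ?C) \<le> int (card R) * int (card ?A)"
      proof -
        have "card R > 0" using R(2) fin by (simp add: card_gt_0_iff)
        moreover have "card R \<le> card D" using RD fin by (intro card_mono)
        ultimately have "0 \<le> (int (card R) - 1) * (int (card D) - int (card R))" by simp
        then have "int (card D) \<le> int (card R) * (int (card (D - R)) + 1)"
          unfolding cV by (simp add: algebra_simps)
        then have "int (card D) * int (card ?C)
            \<le> int (card R) * (int (card (D - R)) + 1) * int (card ?C)"
          by (rule mult_right_mono) simp
        also have "\<dots> = int (card R) * int ((card (D - R) + 1) * card ?C)"
          by (simp add: algebra_simps)
        also have "\<dots> \<le> int (card R) * int (card ?A)"
          using card_preimage_closed_sets_diff_ge[of V R R f, folded D_def] psubset.hyps RV RD
          by (intro mult_left_mono) (simp_all only: of_nat_le_iff of_nat_0_le_iff subset_refl)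
        finally show ?thesis .
      qed
      ultimately show ?thesis by linarith
    qed
    finally show ?thesis .
  qed
qed

theorem theorem2p8:
  fixes V :: "'a set" and f :: "'a \<Rightarrow> 'a"
  assumes "finite V" and "f \<in> V \<rightarrow> V"
  shows "NDS V (order_ideals V (functional_preorder V f)) \<le> 0"
  unfolding order_ideals_functional_preorder[OF assms(2)]
  using assms(1) by (rule NDS_preimage_closed_sets_nonpos)

end
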